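(* The non-commutative version of the Kondratiev space, $\bigcup_{p\in\mathbb{N}}L_2(\tilde\ell,\mu_p)$ with $\mu_p(\alpha)=(2\mathbb{N})^{-\alpha p}$, is a strong convolution algebra; that is, there exist a non negative integer $d$ and, for every $p>q+d$, a positive constant $A_{p,q}$ such that for every $f\in L_2(\tilde\ell,\mu_q)$ and $g\in L_2(\tilde\ell,\mu_p)$, $$\|f*g\|_p\le A_{p,q}\|f\|_q\|g\|_p\quad\text{and}\quad\|g*f\|_p\le A_{p,q}\|f\|_q\|g\|_p.$$
   Context: $\tilde\ell$ is the free (non-commutative) semi-group, with the empty word as identity, generated by $\mathbb N=\{1,2,\dots\}$ (generators $z_1,z_2,\dots$), viewed inside the free group on the same generators (a discrete group, whose Haar measure is the counting measure). For $\alpha=z_{i_1}^{\alpha_1}z_{i_2}^{\alpha_2}\cdots z_{i_n}^{\alpha_n}\in\tilde\ell$ (with $i_1\ne i_2\ne\cdots\ne i_n$), $(2\mathbb N)^\alpha=\prod_{k=1}^n(2i_k)^{\alpha_k}$, and $(2\mathbb N)^{-\alpha p}=\big((2\mathbb N)^{\alpha}\big)^{-p}$. $L_2(\tilde\ell,\mu_p)$ is the space of $f:\tilde\ell\to\mathbb C$ with $\|f\|_p^2=\sum_{\alpha\in\tilde\ell}|f(\alpha)|^2(2\mathbb N)^{-\alpha p}<\infty$. The convolution is $(f*g)(\alpha)=\sum_{(\beta,\gamma)\in\tilde\ell\times\tilde\ell,\ \beta\gamma=\alpha}f(\beta)g(\gamma)$ (a finite sum). *)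

theory Defs
  imports "HOL-Analysis.Analysis"
begin

(* The free semi-group with identity on z_1, z_2, ...: the word z_{i_1} z_{i_2} ... is the list
   [i_1, i_2, ...] of its indices, multiplication is append.  Since the natural numbers of
   Isabelle start at 0, the letters are restricted to positive numbers. *)
definition words :: "nat list set" where
  "words = lists {1..}"

(* (2N)^alpha, with each power of a generator written out as a repeated letter;
   twoN_syllables below is the formula in terms of powers. *)
definition twoN :: "nat list \<Rightarrow> real" where
  "twoN \<alpha> = (\<Prod>i\<leftarrow>\<alpha>. 2 * real i)"

lemma twoN_syllables:
  "twoN (concat (map (\<lambda>(i, a). replicate a i) s)) = (\<Prod>(i, a)\<leftarrow>s. (2 * real i) ^ a)"
proof (induction s)
  case Nil
  show ?case by (simp add: twoN_def)
next
  case (Cons x s)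
  have "(\<Prod>j\<leftarrow>replicate a i. 2 * real j) = (2 * real i) ^ a" for a i
    by (induction a) simp_all
  with Cons show ?case by (cases x) (simp add: twoN_def)
qed

definition kondratiev_weight :: "nat \<Rightarrow> nat list \<Rightarrow> real" where
  "kondratiev_weight p \<alpha> = twoN \<alpha> powi (- int p)"

(* A function on words is represented by its extension by 0 to all lists. *)
definition L2 :: "(nat list \<Rightarrow> real) \<Rightarrow> (nat list \<Rightarrow> complex) set" where
  "L2 \<mu> = {f. (\<forall>\<alpha>. \<alpha> \<notin> words \<longrightarrow> f \<alpha> = 0) \<and> (\<lambda>\<alpha>. (cmod (f \<alpha>))\<^sup>2 * \<mu> \<alpha>) summable_on words}"

definition L2_norm :: "(nat list \<Rightarrow> real) \<Rightarrow> (nat list \<Rightarrow> complex) \<Rightarrow> real" where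
  "L2_norm \<mu> f = sqrt (\<Sum>\<^sub>\<infinity>\<alpha>\<in>words. (cmod (f \<alpha>))\<^sup>2 * \<mu> \<alpha>)"

definition convolution ::
  "(nat list \<Rightarrow> complex) \<Rightarrow> (nat list \<Rightarrow> complex) \<Rightarrow> nat list \<Rightarrow> complex" where
  "convolution f g \<alpha> = (\<Sum>(\<beta>, \<gamma>)\<in>{(\<beta>, \<gamma>) \<in> words \<times> words. \<beta> @ \<gamma> = \<alpha>}. f \<beta> * g \<gamma>)"

lemma finite_factorizations: "finite {(\<beta>, \<gamma>) \<in> words \<times> words. \<beta> @ \<gamma> = \<alpha>}"
proof (rule finite_subset)
  show "{(\<beta>, \<gamma>) \<in> words \<times> words. \<beta> @ \<gamma> = \<alpha>} \<subseteq> (\<lambda>n. (take n \<alpha>, drop n \<alpha>)) ` {..length \<alpha>}"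
  proof
    fix x assume "x \<in> {(\<beta>, \<gamma>) \<in> words \<times> words. \<beta> @ \<gamma> = \<alpha>}"
    then obtain \<beta> \<gamma> where "x = (\<beta>, \<gamma>)" "\<beta> @ \<gamma> = \<alpha>" by auto
    then show "x \<in> (\<lambda>n. (take n \<alpha>, drop n \<alpha>)) ` {..length \<alpha>}"
      by (intro image_eqI[of _ _ "length \<beta>"]) auto
  qed
qed simp

(* For the union over p >= 1 of the spaces L2 (mu p).  The inequalities for norms are meaningful
   only together with membership, because infsum is 0 for a family that is not summable. *)
definition strong_convolution_algebra :: "(nat \<Rightarrow> nat list \<Rightarrow> real) \<Rightarrow> bool" where
  "strong_convolution_algebra \<mu> \<longleftrightarrow>
    (\<exists>d::nat. \<forall>p\<ge>1. \<forall>q\<ge>1. p > q + d \<longrightarrow>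
      (\<exists>A::real. A > 0 \<and>
        (\<forall>f\<in>L2 (\<mu> q). \<forall>g\<in>L2 (\<mu> p).
          convolution f g \<in> L2 (\<mu> p) \<and>
          L2_norm (\<mu> p) (convolution f g) \<le> A * L2_norm (\<mu> q) f * L2_norm (\<mu> p) g \<and>
          convolution g f \<in> L2 (\<mu> p) \<and>
          L2_norm (\<mu> p) (convolution g f) \<le> A * L2_norm (\<mu> q) f * L2_norm (\<mu> p) g)))"

end

(* The weights are multiplicative on words, so F = |f| mu_p^{1/2} and G = |g| mu_p^{1/2} reduce
   the claim to Young's inequality ||F * G||_2 <= ||F||_1 ||G||_2 for the convolution of words.
   By Cauchy-Schwarz, ||F||_1^2 is at most ||f||_q^2 times the sum of (2N)^{-alpha (p-q)} over all
   words alpha, the geometric series with ratio the sum of (2i)^{-(p-q)} over i >= 1.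
   For p - q >= 2 this ratio is at most 1/2, so d = 1 and A = sqrt 2 will do. *)
theory Submission imports Defs begin

section \<open>Positivity and multiplicativity of the weights\<close>

lemma words_Cons_iff: "i # xs \<in> words \<longleftrightarrow> 1 \<le> i \<and> xs \<in> words"
  by (auto simp: words_def)

lemma words_append_iff: "xs @ ys \<in> words \<longleftrightarrow> xs \<in> words \<and> ys \<in> words"
  by (auto simp: words_def)

lemma twoN_append: "twoN (xs @ ys) = twoN xs * twoN ys"
  by (simp add: twoN_def)

lemma twoN_pos: "\<alpha> \<in> words \<Longrightarrow> twoN \<alpha> > 0"
  by (induction \<alpha>) (auto simp: twoN_def words_Cons_iff)

lemma kondratiev_weight_pos: "\<alpha> \<in> words \<Longrightarrow> kondratiev_weight p \<alpha> > 0"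
  by (simp add: kondratiev_weight_def twoN_pos)

lemma kondratiev_weight_append:
  "kondratiev_weight p (xs @ ys) = kondratiev_weight p xs * kondratiev_weight p ys"
  by (simp add: kondratiev_weight_def twoN_append power_int_mult_distrib)

text \<open>Used to split the weight of index p into those of q and p - q before
  Cauchy-Schwarz.\<close>

lemma kondratiev_weight_add:
  "kondratiev_weight (p + q) \<alpha> = kondratiev_weight p \<alpha> * kondratiev_weight q \<alpha>"
  by (simp add: kondratiev_weight_def power_int_minus power_add flip: of_nat_add)

section \<open>The sum of the weights over all words\<close>

lemma sum_inverse_even_squares_le: "(\<Sum>i=1..N. 1 / (2 * real i)\<^sup>2) \<le> 1/2 - 1 / (4 * real N)"
proof (induction N)
  case (Suc N)
  show ?case
  \<comment> \<open>The step from 0 to 1 is separate because \<open>1 / (4 * real 0)\<close> is 0,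
    so the telescoping estimate fails there. At 1 both sides of the goal equal 1/4.\<close>
  proof (cases "N = 0")
    case False
    \<comment> \<open>The right-hand side is 1/(4N(N+1)). The subtracted term in the claim is there
      to make these differences telescope.\<close>
    have "1 / (2 * real (Suc N))\<^sup>2 \<le> 1 / (4 * real N) - 1 / (4 * real (Suc N))"
      using False
      by (simp add: divide_simps) (simp add: algebra_simps power2_eq_square)
    moreover have "(\<Sum>i=1..Suc N. 1 / (2 * real i)\<^sup>2)
        = (\<Sum>i=1..N. 1 / (2 * real i)\<^sup>2) + 1 / (2 * real (Suc N))\<^sup>2"
      by (simp only: sum.cl_ivl_Suc) simp
    ultimately show ?thesis using Suc by linarith
  qed simp
qed simp

text \<open>Since 2i \<ge> 1 for every letter i, a larger exponent only decreases the weight, and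
  the case r = 2 dominates.\<close>

lemma sum_kondratiev_weight_letters_le:
  assumes "r \<ge> 2"
  shows "(\<Sum>i=1..N. kondratiev_weight r [i]) \<le> 1/2"
proof -
  have "kondratiev_weight r [i] \<le> 1 / (2 * real i)\<^sup>2" if "i \<ge> 1" for i
    using that power_increasing[OF assms, of "2 * real i"]
    by (auto simp: kondratiev_weight_def twoN_def power_int_minus inverse_eq_divide
        intro!: divide_left_mono)
  then have "(\<Sum>i=1..N. kondratiev_weight r [i]) \<le> (\<Sum>i=1..N. 1 / (2 * real i)\<^sup>2)"
    by (intro sum_mono) auto
  also have "\<dots> \<le> 1/2 - 1 / (4 * real N)" by (rule sum_inverse_even_squares_le)
  also have "\<dots> \<le> 1/2" by simp
  finally show ?thesis .
qed

text \<open>With c the sum over the letters, the sums over words of length at most n satisfy T(n+1)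
  = 1 + c T(n). As c \<le> 1/2, the bound 2 persists, being the fixed point of t = 1 + t/2.
  Truncating both alphabet and length keeps all sums finite.\<close>

lemma sum_kondratiev_weight_bounded_words_le:
  assumes "r \<ge> 2"
  shows "(\<Sum>\<alpha> | set \<alpha> \<subseteq> {1..N} \<and> length \<alpha> \<le> n. kondratiev_weight r \<alpha>) \<le> 2"
proof (induction n)
  case 0
  have "{\<alpha>. set \<alpha> \<subseteq> {1..N} \<and> length \<alpha> \<le> 0} = {[]}" by auto
  then show ?case by (simp add: kondratiev_weight_def twoN_def)
next
  case (Suc n)
  define W where "W = {\<alpha>. set \<alpha> \<subseteq> {1..N} \<and> length \<alpha> \<le> n}"
  have fin: "finite W" unfolding W_def by (rule finite_lists_length_le) simp
  have "W \<subseteq> words" by (auto simp: W_def words_def)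
  then have nonneg: "0 \<le> (\<Sum>\<alpha>\<in>W. kondratiev_weight r \<alpha>)"
    by (intro sum_nonneg less_imp_le kondratiev_weight_pos) auto
  \<comment> \<open>A nonempty word is split into its first letter and the rest. The form
    \<open>[i] @ \<alpha>\<close> instead of \<open>i # \<alpha>\<close> lets
    \<open>kondratiev_weight_append\<close> apply.\<close>
  have "{\<alpha>. set \<alpha> \<subseteq> {1..N} \<and> length \<alpha> \<le> Suc n} = insert [] ((\<lambda>(i, \<alpha>). [i] @ \<alpha>) ` ({1..N} \<times> W))"
    (is "?L = ?R")
  proof
    show "?L \<subseteq> ?R"
    proof
      fix \<alpha> assume "\<alpha> \<in> ?L"
      then show "\<alpha> \<in> ?R" by (cases \<alpha>) (auto simp: W_def)
    qed
  qed (auto simp: W_def)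
  moreover have "inj_on (\<lambda>(i, \<alpha>). [i] @ \<alpha>) ({1..N} \<times> W)"
    by (auto intro!: inj_onI)
  ultimately have "(\<Sum>\<alpha>\<in>?L. kondratiev_weight r \<alpha>)
      = kondratiev_weight r [] + (\<Sum>(i, \<alpha>)\<in>{1..N} \<times> W. kondratiev_weight r ([i] @ \<alpha>))"
    using fin by (simp add: sum.reindex case_prod_unfold o_def image_iff)
  also have "\<dots> = 1 + (\<Sum>i=1..N. kondratiev_weight r [i]) * (\<Sum>\<alpha>\<in>W. kondratiev_weight r \<alpha>)"
    unfolding kondratiev_weight_append sum_product
    by (simp add: sum.cartesian_product kondratiev_weight_def twoN_def)
  also have "\<dots> \<le> 1 + 1/2 * 2"
    using sum_kondratiev_weight_letters_le[OF assms, of N] Suc.IH nonneg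
    by (intro add_left_mono mult_mono) (auto simp: W_def)
  finally show ?case by simp
qed

text \<open>A finite set of words has bounded letters and bounded lengths, so it lies in one of the
  truncated sets; the weights are positive there.\<close>

lemma sum_kondratiev_weight_le:
  assumes "r \<ge> 2" "finite S" "S \<subseteq> words"
  shows "(\<Sum>\<alpha>\<in>S. kondratiev_weight r \<alpha>) \<le> 2"
proof -
  obtain N where N: "\<Union> (set ` S) \<subseteq> {..N}"
    using finite_nat_set_iff_bounded_le[of "\<Union> (set ` S)"] assms(2) by auto
  obtain n where n: "length ` S \<subseteq> {..n}"
    using finite_nat_set_iff_bounded_le[of "length ` S"] assms(2) by auto
  let ?W = "{\<alpha>. set \<alpha> \<subseteq> {1..N} \<and> length \<alpha> \<le> n}"
  have "S \<subseteq> ?W" using assms(3) N n by (fastforce simp: words_def)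
  moreover have "finite ?W" by (rule finite_lists_length_le) simp
  moreover have "?W \<subseteq> words" by (auto simp: words_def)
  ultimately have "(\<Sum>\<alpha>\<in>S. kondratiev_weight r \<alpha>) \<le> (\<Sum>\<alpha>\<in>?W. kondratiev_weight r \<alpha>)"
    by (intro sum_mono2) (auto intro!: less_imp_le kondratiev_weight_pos)
  also have "\<dots> \<le> 2" by (rule sum_kondratiev_weight_bounded_words_le[OF assms(1)])
  finally show ?thesis .
qed

section \<open>Passing between norms and finite partial sums\<close>

lemma L2_norm_nonneg:
  assumes "\<And>\<alpha>. \<alpha> \<in> words \<Longrightarrow> \<mu> \<alpha> \<ge> 0"
  shows "L2_norm \<mu> f \<ge> 0"
  unfolding L2_norm_def using assms by (auto intro!: infsum_nonneg)

lemma sum_le_L2_norm_squared: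
  assumes "\<And>\<alpha>. \<alpha> \<in> words \<Longrightarrow> \<mu> \<alpha> \<ge> 0" and "f \<in> L2 \<mu>" and "finite S" "S \<subseteq> words"
  shows "(\<Sum>\<alpha>\<in>S. (cmod (f \<alpha>))\<^sup>2 * \<mu> \<alpha>) \<le> (L2_norm \<mu> f)\<^sup>2"
proof -
  \<comment> \<open>Needed for the square to cancel the square root in
    \<open>L2_norm\<close>.\<close>
  have "0 \<le> (\<Sum>\<^sub>\<infinity>\<alpha>\<in>words. (cmod (f \<alpha>))\<^sup>2 * \<mu> \<alpha>)"
    using assms(1) by (auto intro!: infsum_nonneg)
  then show ?thesis
    using assms unfolding L2_norm_def L2_def by (auto intro!: finite_sum_le_infsum)
qed

text \<open>The terms are non-negative, so a uniform bound on finite sums yields both summability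
  and the bound on the infinite sum. All later estimates can therefore be made on finite sets of
  words.\<close>

lemma L2_boundedI:
  assumes \<mu>: "\<And>\<alpha>. \<alpha> \<in> words \<Longrightarrow> \<mu> \<alpha> \<ge> 0" and "\<And>\<alpha>. \<alpha> \<notin> words \<Longrightarrow> f \<alpha> = 0" and "B \<ge> 0"
    and bound: "\<And>S. finite S \<Longrightarrow> S \<subseteq> words \<Longrightarrow> (\<Sum>\<alpha>\<in>S. (cmod (f \<alpha>))\<^sup>2 * \<mu> \<alpha>) \<le> B\<^sup>2"
  shows "f \<in> L2 \<mu>" and "L2_norm \<mu> f \<le> B"
proof -
  have summable: "(\<lambda>\<alpha>. (cmod (f \<alpha>))\<^sup>2 * \<mu> \<alpha>) summable_on words"
    by (rule nonneg_bdd_above_summable_on) (use \<mu> bound in \<open>auto intro!: bdd_aboveI\<close>)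
  then show "f \<in> L2 \<mu>" using assms(2) by (simp add: L2_def)
  have "(\<Sum>\<^sub>\<infinity>\<alpha>\<in>words. (cmod (f \<alpha>))\<^sup>2 * \<mu> \<alpha>) \<le> B\<^sup>2"
    by (rule infsum_le_finite_sums[OF summable bound])
  then show "L2_norm \<mu> f \<le> B"
    unfolding L2_norm_def using \<open>B \<ge> 0\<close> by (intro real_le_lsqrt)
qed

section \<open>Young's inequality on finite sets\<close>

text \<open>\<open>Q \<alpha>\<close> plays the role of the set of factorizations of \<open>\<alpha>\<close>, in either order of the factors.\<close>

lemma Young_inequality_finite:
  fixes F :: "'a \<Rightarrow> real" and G :: "'b \<Rightarrow> real" and Q :: "'i \<Rightarrow> ('a \<times> 'b) set"
  assumes "finite S" and fin: "\<And>\<alpha>. \<alpha> \<in> S \<Longrightarrow> finite (Q \<alpha>)"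
    and sub: "\<And>\<alpha>. \<alpha> \<in> S \<Longrightarrow> Q \<alpha> \<subseteq> A \<times> B"
    and inj: "\<And>\<alpha>. \<alpha> \<in> S \<Longrightarrow> inj_on fst (Q \<alpha>)"
    and disj: "disjoint_family_on Q S"
    and F: "\<And>\<beta>. \<beta> \<in> A \<Longrightarrow> F \<beta> \<ge> 0"
    and M: "\<And>T. finite T \<Longrightarrow> T \<subseteq> A \<Longrightarrow> (\<Sum>\<beta>\<in>T. F \<beta>) \<le> M"
    and K: "\<And>T. finite T \<Longrightarrow> T \<subseteq> B \<Longrightarrow> (\<Sum>\<gamma>\<in>T. (G \<gamma>)\<^sup>2) \<le> K"
  shows "(\<Sum>\<alpha>\<in>S. (\<Sum>(\<beta>, \<gamma>)\<in>Q \<alpha>. F \<beta> * G \<gamma>)\<^sup>2) \<le> M\<^sup>2 * K"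
proof -
  have "M \<ge> 0" using M[of "{}"] by simp
  define P where "P = (\<Union>\<alpha>\<in>S. Q \<alpha>)"
  have P: "finite P" "P \<subseteq> A \<times> B" using assms(1) fin sub by (auto simp: P_def)
  have "(\<Sum>(\<beta>, \<gamma>)\<in>Q \<alpha>. F \<beta> * G \<gamma>)\<^sup>2 \<le> M * (\<Sum>(\<beta>, \<gamma>)\<in>Q \<alpha>. F \<beta> * (G \<gamma>)\<^sup>2)" if \<alpha>: "\<alpha> \<in> S" for \<alpha>
  proof -
    have FQ: "F (fst x) \<ge> 0" if "x \<in> Q \<alpha>" for x
      using F sub[OF \<alpha>] that by auto
    \<comment> \<open>Writing F G as sqrt F times (sqrt F) G lets Cauchy-Schwarz split off a factor
      that involves F alone and is bounded by M.\<close>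
    have "(\<Sum>(\<beta>, \<gamma>)\<in>Q \<alpha>. F \<beta> * G \<gamma>)\<^sup>2
        = (\<Sum>x\<in>Q \<alpha>. sqrt (F (fst x)) * (sqrt (F (fst x)) * G (snd x)))\<^sup>2"
      using FQ by (intro arg_cong[where f = "\<lambda>s. s\<^sup>2"] sum.cong)
        (auto simp: case_prod_unfold simp flip: mult.assoc)
    also have "\<dots> \<le> (\<Sum>x\<in>Q \<alpha>. (sqrt (F (fst x)))\<^sup>2) * (\<Sum>x\<in>Q \<alpha>. (sqrt (F (fst x)) * G (snd x))\<^sup>2)"
      by (rule Cauchy_Schwarz_ineq_sum)
    also have "\<dots> = (\<Sum>x\<in>Q \<alpha>. F (fst x)) * (\<Sum>x\<in>Q \<alpha>. F (fst x) * (G (snd x))\<^sup>2)"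
      using FQ by (simp add: power_mult_distrib)
    also have "\<dots> \<le> M * (\<Sum>x\<in>Q \<alpha>. F (fst x) * (G (snd x))\<^sup>2)"
    proof (rule mult_right_mono)
      \<comment> \<open>By injectivity of \<open>fst\<close> each \<beta> occurs at most once, so
        this is a sum of F over a finite subset of A.\<close>
      have "(\<Sum>x\<in>Q \<alpha>. F (fst x)) = (\<Sum>\<beta>\<in>fst ` Q \<alpha>. F \<beta>)"
        by (simp add: sum.reindex[OF inj[OF \<alpha>]] o_def)
      also have "\<dots> \<le> M" using fin[OF \<alpha>] sub[OF \<alpha>] by (intro M) auto
      finally show "(\<Sum>x\<in>Q \<alpha>. F (fst x)) \<le> M" .
    qed (use FQ in \<open>auto intro!: sum_nonneg\<close>)
    finally show ?thesis by (simp add: case_prod_unfold)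
  qed
  then have "(\<Sum>\<alpha>\<in>S. (\<Sum>(\<beta>, \<gamma>)\<in>Q \<alpha>. F \<beta> * G \<gamma>)\<^sup>2)
      \<le> M * (\<Sum>\<alpha>\<in>S. \<Sum>(\<beta>, \<gamma>)\<in>Q \<alpha>. F \<beta> * (G \<gamma>)\<^sup>2)"
    unfolding sum_distrib_left[of M] by (rule sum_mono)
  also have "(\<Sum>\<alpha>\<in>S. \<Sum>(\<beta>, \<gamma>)\<in>Q \<alpha>. F \<beta> * (G \<gamma>)\<^sup>2) = (\<Sum>(\<beta>, \<gamma>)\<in>P. F \<beta> * (G \<gamma>)\<^sup>2)"
    unfolding P_def using assms(1) fin disj
    by (intro sum.UNION_disjoint[symmetric]) (auto simp: disjoint_family_on_def)
  \<comment> \<open>Enlarging P to the full rectangle adds only non-negative terms, and over a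
    rectangle the sum factors.\<close>
  also have "\<dots> \<le> (\<Sum>(\<beta>, \<gamma>)\<in>fst ` P \<times> snd ` P. F \<beta> * (G \<gamma>)\<^sup>2)"
    using P F by (intro sum_mono2) (force intro!: mult_nonneg_nonneg simp: image_iff)+
  also have "\<dots> = (\<Sum>\<beta>\<in>fst ` P. F \<beta>) * (\<Sum>\<gamma>\<in>snd ` P. (G \<gamma>)\<^sup>2)"
    by (simp add: sum_product sum.cartesian_product)
  also have "\<dots> \<le> M * K"
    using P \<open>M \<ge> 0\<close> by (intro mult_mono M K sum_nonneg) auto
  finally show ?thesis using \<open>M \<ge> 0\<close> by (simp add: power2_eq_square mult.assoc mult_left_mono)
qed

section \<open>Estimates for the convolution of words\<close>

lemma convolution_eq_0: "\<alpha> \<notin> words \<Longrightarrow> convolution f g \<alpha> = 0"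
  unfolding convolution_def by (rule sum.neutral) (auto simp: words_append_iff)

text \<open>Whenever \<beta> @ \<gamma> = \<alpha>, the weight of \<alpha> is the product of those
  of \<beta> and \<gamma>, so its square root can be moved inside the convolution sum and shared
  between the two factors.\<close>

lemma cmod_convolution_le:
  assumes "\<alpha> \<in> words"
  shows "(cmod (convolution f g \<alpha>))\<^sup>2 * kondratiev_weight p \<alpha>
    \<le> (\<Sum>(\<beta>, \<gamma>)\<in>{(\<beta>, \<gamma>) \<in> words \<times> words. \<beta> @ \<gamma> = \<alpha>}.
         (cmod (f \<beta>) * sqrt (kondratiev_weight p \<beta>)) * (cmod (g \<gamma>) * sqrt (kondratiev_weight p \<gamma>)))\<^sup>2"
    (is "?l \<le> ?r\<^sup>2")
proof -
  let ?Q = "{(\<beta>, \<gamma>) \<in> words \<times> words. \<beta> @ \<gamma> = \<alpha>}"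
  have w: "kondratiev_weight p \<alpha> \<ge> 0" using kondratiev_weight_pos[OF assms] by (rule less_imp_le)
  have "cmod (convolution f g \<alpha>) * sqrt (kondratiev_weight p \<alpha>)
      \<le> (\<Sum>(\<beta>, \<gamma>)\<in>?Q. cmod (f \<beta> * g \<gamma>)) * sqrt (kondratiev_weight p \<alpha>)"
    unfolding convolution_def case_prod_unfold
    using w by (intro mult_right_mono norm_sum) auto
  also have "\<dots> = ?r"
    unfolding sum_distrib_right
    by (rule sum.cong) (auto simp: norm_mult kondratiev_weight_append real_sqrt_mult)
  finally have "(cmod (convolution f g \<alpha>) * sqrt (kondratiev_weight p \<alpha>))\<^sup>2 \<le> ?r\<^sup>2"
    using w by (intro power_mono) auto
  then show ?thesis using w by (simp add: power_mult_distrib)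
qed

text \<open>The gap between q and p enters here: it turns square summability with weight q into
  absolute summability with the square root of weight p. The constant 2 under the root is the bound
  on the total weight of index p - q.\<close>

lemma sum_sqrt_kondratiev_weight_le:
  assumes "p \<ge> q + 2" and f: "f \<in> L2 (kondratiev_weight q)" and S: "finite S" "S \<subseteq> words"
  shows "(\<Sum>\<alpha>\<in>S. cmod (f \<alpha>) * sqrt (kondratiev_weight p \<alpha>))
    \<le> sqrt 2 * L2_norm (kondratiev_weight q) f"
proof -
  define r where "r = p - q"
  have r: "r \<ge> 2" "p = q + r" using assms(1) by (auto simp: r_def)
  have nonneg: "\<alpha> \<in> words \<Longrightarrow> 0 \<le> kondratiev_weight k \<alpha>" for k \<alpha>
    by (rule less_imp_le[OF kondratiev_weight_pos])
  have "(\<Sum>\<alpha>\<in>S. cmod (f \<alpha>) * sqrt (kondratiev_weight p \<alpha>))\<^sup>2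
      = (\<Sum>\<alpha>\<in>S. (cmod (f \<alpha>) * sqrt (kondratiev_weight q \<alpha>)) * sqrt (kondratiev_weight r \<alpha>))\<^sup>2"
    unfolding r kondratiev_weight_add by (simp add: real_sqrt_mult mult.assoc)
  also have "\<dots> \<le> (\<Sum>\<alpha>\<in>S. (cmod (f \<alpha>) * sqrt (kondratiev_weight q \<alpha>))\<^sup>2)
      * (\<Sum>\<alpha>\<in>S. (sqrt (kondratiev_weight r \<alpha>))\<^sup>2)"
    by (rule Cauchy_Schwarz_ineq_sum)
  also have "\<dots> = (\<Sum>\<alpha>\<in>S. (cmod (f \<alpha>))\<^sup>2 * kondratiev_weight q \<alpha>) * (\<Sum>\<alpha>\<in>S. kondratiev_weight r \<alpha>)"
    using S nonneg by (intro arg_cong2[where f = "(*)"] sum.cong) (auto simp: power_mult_distrib)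
  also have "\<dots> \<le> (L2_norm (kondratiev_weight q) f)\<^sup>2 * 2"
    using S nonneg
    by (intro mult_mono sum_le_L2_norm_squared sum_kondratiev_weight_le r f sum_nonneg) auto
  also have "\<dots> = (sqrt 2 * L2_norm (kondratiev_weight q) f)\<^sup>2"
    by (simp add: power_mult_distrib)
  finally show ?thesis
    by (rule power2_le_imp_le) (auto intro!: mult_nonneg_nonneg L2_norm_nonneg nonneg)
qed

lemma convolution_L2:
  assumes pq: "p \<ge> q + 2"
    and f: "f \<in> L2 (kondratiev_weight q)" and g: "g \<in> L2 (kondratiev_weight p)"
  defines "B \<equiv> sqrt 2 * L2_norm (kondratiev_weight q) f * L2_norm (kondratiev_weight p) g"
  shows "convolution f g \<in> L2 (kondratiev_weight p)"
    and "L2_norm (kondratiev_weight p) (convolution f g) \<le> B"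
    and "convolution g f \<in> L2 (kondratiev_weight p)"
    and "L2_norm (kondratiev_weight p) (convolution g f) \<le> B"
proof -
  have nonneg: "\<alpha> \<in> words \<Longrightarrow> 0 \<le> kondratiev_weight k \<alpha>" for k \<alpha>
    by (rule less_imp_le[OF kondratiev_weight_pos])
  have B: "B \<ge> 0" unfolding B_def by (intro mult_nonneg_nonneg L2_norm_nonneg nonneg) auto
  define F where "F = (\<lambda>\<alpha>. cmod (f \<alpha>) * sqrt (kondratiev_weight p \<alpha>))"
  define G where "G = (\<lambda>\<alpha>. cmod (g \<alpha>) * sqrt (kondratiev_weight p \<alpha>))"
  define Q where "Q = (\<lambda>\<alpha>. {(\<beta>, \<gamma>) \<in> words \<times> words. \<beta> @ \<gamma> = \<alpha>})"
  have F0: "F \<beta> \<ge> 0" if "\<beta> \<in> words" for \<beta> using nonneg[OF that] by (simp add: F_def)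
  have F: "(\<Sum>\<beta>\<in>T. F \<beta>) \<le> sqrt 2 * L2_norm (kondratiev_weight q) f"
    if "finite T" "T \<subseteq> words" for T
    unfolding F_def by (rule sum_sqrt_kondratiev_weight_le[OF pq f that])
  have G: "(\<Sum>\<gamma>\<in>T. (G \<gamma>)\<^sup>2) \<le> (L2_norm (kondratiev_weight p) g)\<^sup>2"
    if T: "finite T" "T \<subseteq> words" for T
  proof -
    have "(\<Sum>\<gamma>\<in>T. (G \<gamma>)\<^sup>2) = (\<Sum>\<gamma>\<in>T. (cmod (g \<gamma>))\<^sup>2 * kondratiev_weight p \<gamma>)"
      unfolding G_def using T nonneg by (intro sum.cong) (auto simp: power_mult_distrib)
    then show ?thesis using sum_le_L2_norm_squared[OF nonneg g T] by simp
  qed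
  have B_sq: "(sqrt 2 * L2_norm (kondratiev_weight q) f)\<^sup>2 * (L2_norm (kondratiev_weight p) g)\<^sup>2 = B\<^sup>2"
    by (simp add: B_def power_mult_distrib)
  have Q: "finite (Q \<alpha>)" for \<alpha> unfolding Q_def by (rule finite_factorizations)
  have bound_fg: "(\<Sum>\<alpha>\<in>S. (cmod (convolution f g \<alpha>))\<^sup>2 * kondratiev_weight p \<alpha>) \<le> B\<^sup>2"
    if S: "finite S" "S \<subseteq> words" for S
  proof -
    have "(\<Sum>\<alpha>\<in>S. (cmod (convolution f g \<alpha>))\<^sup>2 * kondratiev_weight p \<alpha>)
        \<le> (\<Sum>\<alpha>\<in>S. (\<Sum>(\<beta>, \<gamma>)\<in>Q \<alpha>. F \<beta> * G \<gamma>)\<^sup>2)"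
      unfolding Q_def F_def G_def using S by (intro sum_mono cmod_convolution_le) auto
    also have "\<dots> \<le> B\<^sup>2"
      unfolding B_sq[symmetric]
      \<comment> \<open>The open premises hold because all factors are words, a prefix of \<alpha>
        determines the remaining suffix, and a pair of factors determines their product.\<close>
      by (rule Young_inequality_finite[OF S(1) Q _ _ _ F0 F G])
        (auto simp: Q_def disjoint_family_on_def inj_on_def)
    finally show ?thesis .
  qed
  show "convolution f g \<in> L2 (kondratiev_weight p)"
    and "L2_norm (kondratiev_weight p) (convolution f g) \<le> B"
    by (rule L2_boundedI[OF nonneg convolution_eq_0 B bound_fg]; assumption)+
  have bound_gf: "(\<Sum>\<alpha>\<in>S. (cmod (convolution g f \<alpha>))\<^sup>2 * kondratiev_weight p \<alpha>) \<le> B\<^sup>2"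
    if S: "finite S" "S \<subseteq> words" for S
  proof -
    have "(\<Sum>\<alpha>\<in>S. (cmod (convolution g f \<alpha>))\<^sup>2 * kondratiev_weight p \<alpha>)
        \<le> (\<Sum>\<alpha>\<in>S. (\<Sum>(\<gamma>, \<beta>)\<in>Q \<alpha>. G \<gamma> * F \<beta>)\<^sup>2)"
      unfolding Q_def F_def G_def using S by (intro sum_mono cmod_convolution_le) auto
    \<comment> \<open>Swapping puts the summable function F in the first coordinate again.
      Injectivity of \<open>fst\<close> now says that a suffix of \<alpha> determines the prefix, so
      right cancellation replaces commutativity.\<close>
    also have "\<dots> = (\<Sum>\<alpha>\<in>S. (\<Sum>(\<beta>, \<gamma>)\<in>prod.swap ` Q \<alpha>. F \<beta> * G \<gamma>)\<^sup>2)"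
      by (simp add: sum.reindex case_prod_unfold mult.commute)
    also have "\<dots> \<le> B\<^sup>2"
      unfolding B_sq[symmetric]
      by (rule Young_inequality_finite[OF S(1) finite_imageI[OF Q] _ _ _ F0 F G])
        (auto simp: Q_def disjoint_family_on_def inj_on_def)
    finally show ?thesis .
  qed
  show "convolution g f \<in> L2 (kondratiev_weight p)"
    and "L2_norm (kondratiev_weight p) (convolution g f) \<le> B"
    by (rule L2_boundedI[OF nonneg convolution_eq_0 B bound_gf]; assumption)+
qed

theorem mainTheorem11: "strong_convolution_algebra kondratiev_weight"
  unfolding strong_convolution_algebra_def
\<comment> \<open>The condition p > q + 1 means p - q \<ge> 2. A gap of 1 would give the divergent
  harmonic series over the letters.\<close>
proof (rule exI[of _ 1], intro allI impI)
  fix p q :: nat assume "p > q + 1"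
  then have "p \<ge> q + 2" by simp
  from convolution_L2[OF this] show "\<exists>A::real. A > 0 \<and>
        (\<forall>f\<in>L2 (kondratiev_weight q). \<forall>g\<in>L2 (kondratiev_weight p).
          convolution f g \<in> L2 (kondratiev_weight p) \<and>
          L2_norm (kondratiev_weight p) (convolution f g)
            \<le> A * L2_norm (kondratiev_weight q) f * L2_norm (kondratiev_weight p) g \<and>
          convolution g f \<in> L2 (kondratiev_weight p) \<and>
          L2_norm (kondratiev_weight p) (convolution g f)
            \<le> A * L2_norm (kondratiev_weight q) f * L2_norm (kondratiev_weight p) g)"
    by (intro exI[of _ "sqrt 2"]) auto
qed

end
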